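(* Let $x \in \mathcal{X}$ be a topology of connections of $n \ge 2$ identical masses by linear springs which admits only a single rigid body mode. For $f \in \mathcal{F} = \{ f \in \mathbb{R}^n : \|f\|_2 \le 1,\ f \cdot e_0 = 0\}$, let $\delta_s = \delta_s(f)$ be the (constant, steady-state) vector of displacements of the masses of the mechanical system due to the constant forcing $f$, where the initial values of the average displacement and of the average velocity of all masses are zero. Then $$\max_{f \in \mathcal{F}} \|\delta_s(f)\|_2 = \frac{1}{\lambda_2(L(x))}.$$
   Context: There are $n$ identical masses (nodes $V=\{1,\dots,n\}$, mass $m>0$ each) and a set $E$ of available springs, spring $e=\{i,j\}\in E$ connecting masses $i$ and $j$ and having stiffness $k_e>0$. A topology of connections is a vector $x\in\{0,1\}^{|E|}$, with $x_e=1$ if and only if spring $e$ is used. The mass matrix is $M=mI_n$ and the stiffness matrix is the weighted graph Laplacian $L(x)=\sum_{e=\{i,j\}\in E} x_e k_e\,(\epsilon_i-\epsilon_j)(\epsilon_i-\epsilon_j)^{T}$, where $\epsilon_i$ is the $i$-th standard basis vector of $\mathbb{R}^n$. The governing equations are $M\ddot\delta + L(x)\delta = f$, where $\delta\in\mathbb{R}^n$ is the vector of displacements and $f\in\mathbb{R}^n$ the vector of (constant) forces. The vector $e_0\in\mathbb{R}^n$ has every component equal to one. The eigenvalues of $L(x)$ are $0=\lambda_1(L(x))\le\lambda_2(L(x))\le\dots\le\lambda_n(L(x))$, counted with multiplicity. $\mathcal{X}$ is the set of topologies $x$ admitting only a single rigid body mode, i.e. the graph of the masses with the selected springs is connected,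 equivalently $\lambda_2(L(x))>0$. The steady-state displacement $\delta_s(f)$ is the time-independent solution of the governing equations with zero average displacement, i.e. the vector with $L(x)\delta_s=f$ and $e_0\cdot\delta_s=0$ (the latter being what zero initial average displacement and velocity mean for it). *)

theory Defs
  imports "HOL-Analysis.Analysis" "HOL-Computational_Algebra.Computational_Algebra"
begin

definition charpoly :: "real^'n^'n \<Rightarrow> real poly" where
  "charpoly A = det (\<chi> i j. (if i = j then [:0, 1:] else 0) - [:A $ i $ j:])"

text \<open>The \<open>i\<close>-th smallest real eigenvalue, counting from \<open>i = 1\<close> and with (algebraic)
  multiplicity. For a symmetric matrix all roots of the characteristic polynomial are real,
  so the list below has length \<open>n\<close>.\<close>

definition eigenvalue_nth :: "nat \<Rightarrow> real^'n^'n \<Rightarrow> real" where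
  "eigenvalue_nth i A = sorted_list_of_multiset (proots (charpoly A)) ! (i - 1)"

text \<open>The masses are the elements of the finite type \<open>'n\<close>, so \<open>n = CARD('n)\<close>. A spring is the
  two-element set of the masses it connects.\<close>

definition springs :: "'n set set \<Rightarrow> bool" where
  "springs E \<longleftrightarrow> (\<forall>e\<in>E. \<exists>i j. i \<noteq> j \<and> e = {i, j})"

definition outer :: "real^'n \<Rightarrow> real^'n \<Rightarrow> real^'n^'n" where
  "outer u v = (\<chi> a b. u $ a * v $ b)"

text \<open>The matrix of a spring does not depend on how its two ends are ordered, which the lemma
  \<open>spring_matrix_doubleton\<close> confirms.\<close>

definition spring_matrix :: "'n set \<Rightarrow> real^'n^'n" where
  "spring_matrix e =
     (THE A. \<exists>i j. e = {i, j} \<and> A = outer (axis i 1 - axis j 1) (axis i 1 - axis j 1))"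

lemma spring_matrix_doubleton:
  fixes i j :: "'n::finite"
  shows "spring_matrix {i, j} = outer (axis i 1 - axis j 1) (axis i 1 - axis j 1)"
proof -
  have swap: "outer (axis j 1 - axis i 1) (axis j 1 - axis i 1)
      = outer (axis i 1 - axis j 1) (axis i 1 - axis j 1 :: real^'n)" for i j
    by (simp add: outer_def vec_eq_iff algebra_simps)
  show ?thesis
    unfolding spring_matrix_def
    by (rule the_equality) (use swap in \<open>auto simp: doubleton_eq_iff\<close>)
qed

definition stiffness :: "'n set set \<Rightarrow> ('n set \<Rightarrow> real) \<Rightarrow> ('n set \<Rightarrow> real) \<Rightarrow> real^'n^'n" where
  "stiffness E k x = (\<Sum>e\<in>E. (x e * k e) *\<^sub>R spring_matrix e)"

definition topologies :: "'n set set \<Rightarrow> ('n set \<Rightarrow> real) set" where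
  "topologies E = (E \<rightarrow>\<^sub>E {0, 1})"

text \<open>A single rigid body mode: the graph of the masses with the selected springs is connected.\<close>

definition single_rigid_body_topologies :: "'n set set \<Rightarrow> ('n set \<Rightarrow> real) set" where
  "single_rigid_body_topologies E =
     {x \<in> topologies E. \<forall>i j. (i, j) \<in> {(a, b). {a, b} \<in> E \<and> x {a, b} = 1}\<^sup>*}"

definition e0 :: "real^'n" where
  "e0 = (\<chi> i. 1)"

definition average :: "real^'n \<Rightarrow> real" where
  "average u = (e0 \<bullet> u) / real CARD('n)"

text \<open>\<open>\<delta>\<close> is a motion with velocity \<open>v\<close> of the system with mass matrix \<open>M\<close> and stiffness matrix
  \<open>K\<close> under the constant force \<open>f\<close>.\<close>

definition motion ::
  "real^'n^'n \<Rightarrow> real^'n^'n \<Rightarrow> real^'n \<Rightarrow> (real \<Rightarrow> real^'n) \<Rightarrow> (real \<Rightarrow> real^'n) \<Rightarrow> bool" where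
  "motion M K f \<delta> v \<longleftrightarrow>
     (\<exists>a. \<forall>t. (\<delta> has_vector_derivative v t) (at t) \<and>
              (v has_vector_derivative a t) (at t) \<and>
              M *v a t + K *v \<delta> t = f)"

definition steady_state :: "real^'n^'n \<Rightarrow> real^'n^'n \<Rightarrow> real^'n \<Rightarrow> real^'n" where
  "steady_state M K f =
     (THE d. \<exists>v. motion M K f (\<lambda>t. d) v \<and> average d = 0 \<and> average (v 0) = 0)"

definition admissible_forces :: "(real^'n) set" where
  "admissible_forces = {f. norm f \<le> 1 \<and> f \<bullet> e0 = 0}"

end

theory Submission
  imports Defs
begin

text \<open>A constant displacement has no acceleration, so the steady state for a constant forcing
  \<open>f\<close> with zero mean is the preimage of \<open>f\<close> under the stiffness matrix \<open>L\<close> that is orthogonal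
  to \<open>e0\<close> (\<open>motion_constant_iff\<close>). So the claim is that the inverse of \<open>L\<close>
  on the orthogonal complement of \<open>e0\<close> has operator norm \<open>1 / \<lambda>\<^sub>2\<close>.

  The matrix \<open>L\<close> is symmetric and thus has an orthonormal eigenbasis
  (\<open>symmetric_matrix_has_orthonormal_eigenbasis\<close>). Its quadratic form is the elastic energy, a sum
  of squared elongations with positive weights, which vanishes only when all masses are displaced
  equally, as the network is connected (\<open>stiffness_kernel\<close>). Hence exactly one of the eigenvalues
  of the basis is zero, the others are positive (\<open>stiffness_spectrum\<close>), and the least of these
  others is \<open>\<lambda>\<^sub>2\<close>: the characteristic polynomial splits into the linear factors given by the basis,
  so sorting its roots puts the zero first and that eigenvalue second (\<open>eigenvalue_nth_2_eigenbasis\<close>).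

  In the coordinates of the basis the steady state divides every nonrigid coordinate of \<open>f\<close> by its
  eigenvalue, which is at least \<open>\<lambda>\<^sub>2\<close> (\<open>steady_state_eigenbasis\<close>). Parseval's identity gives the
  upper bound, and a unit eigenvector for \<open>\<lambda>\<^sub>2\<close>, taken as the forcing, attains it.\<close>

section \<open>Orthonormal eigenbases of symmetric matrices\<close>

text \<open>A maximiser \<open>v\<close> of the Rayleigh quotient on the unit sphere of the subspace is an eigenvector:
  with \<open>c\<close> the maximum, the quadratic form of \<open>c \<cdot> id - f\<close> is nonnegative and vanishes at \<open>v\<close>,
  so its first variation \<open>r = c v - f v\<close> must be zero.\<close>

lemma selfadjoint_eigenvector_in_invariant_subspace:
  fixes f :: "'a::euclidean_space \<Rightarrow> 'a"
  assumes lin: "linear f" and sym: "\<And>x y. f x \<bullet> y = x \<bullet> f y"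
    and S: "subspace S" "f ` S \<subseteq> S" "S \<noteq> {0}"
  obtains v c where "v \<in> S" "norm v = 1" "f v = c *\<^sub>R v"
proof -
  obtain u where u: "u \<in> S" "u \<noteq> 0"
    using S(1,3) subspace_0 by blast
  let ?K = "S \<inter> sphere 0 1"
  have "u /\<^sub>R norm u \<in> ?K"
    using u S(1) by (simp add: subspace_scale)
  moreover have "compact ?K"
    by (simp add: S(1) closed_Int_compact closed_subspace)
  moreover have "continuous_on ?K (\<lambda>x. x \<bullet> f x)"
    by (intro continuous_intros linear_continuous_on linear_linear[THEN iffD1] lin)
       (simp add: lin linear_conv_bounded_linear[symmetric])
  ultimately obtain v where v: "v \<in> ?K" and max: "\<And>w. w \<in> ?K \<Longrightarrow> w \<bullet> f w \<le> v \<bullet> f v"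
    using continuous_attains_sup[of ?K "\<lambda>x. x \<bullet> f x"] by blast
  define c where "c = v \<bullet> f v"
  define g where "g w = c * (w \<bullet> w) - w \<bullet> f w" for w
  have nonneg: "g w \<ge> 0" if w: "w \<in> S" for w
  proof (cases "w = 0")
    case False
    have "w /\<^sub>R norm w \<in> ?K"
      using w False S(1) by (simp add: subspace_scale)
    then have "(w /\<^sub>R norm w) \<bullet> f (w /\<^sub>R norm w) \<le> c"
      unfolding c_def by (rule max)
    then have "(w \<bullet> f w) / (norm w)\<^sup>2 \<le> c"
      by (simp add: linear_scale[OF lin] power2_eq_square divide_simps)
    then show ?thesis
      using False by (simp add: g_def divide_simps dot_square_norm)
  qed (simp add: g_def linear_0[OF lin])
  define r where "r = c *\<^sub>R v - f v"
  have vS: "v \<in> S" and nv: "norm v = 1"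
    using v by auto
  have rS: "r \<in> S"
    unfolding r_def using S vS by (auto intro!: subspace_diff subspace_scale)
  have "g (v + t *\<^sub>R r) = 2 * t * (r \<bullet> r) + t\<^sup>2 * g r" for t
  proof -
    have cross: "r \<bullet> f v = v \<bullet> f r"
      by (metis inner_commute sym)
    have "g (v + t *\<^sub>R r) = g v + 2 * t * (c * (v \<bullet> r) - v \<bullet> f r) + t\<^sup>2 * g r"
      by (simp add: g_def linear_add[OF lin] linear_scale[OF lin] inner_add_left inner_add_right
          cross inner_commute[of r v] power2_eq_square algebra_simps)
    moreover have "g v = 0"
      using nv by (simp add: g_def c_def norm_eq_1)
    moreover have "c * (v \<bullet> r) - v \<bullet> f r = r \<bullet> r"
      by (subst (3) r_def) (simp add: inner_diff_left sym)
    ultimately show ?thesis by simp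
  qed
  then have var: "0 \<le> 2 * t * (r \<bullet> r) + t\<^sup>2 * g r" for t
    using nonneg[of "v + t *\<^sub>R r"] vS rS S(1) by (simp add: subspace_add subspace_scale)
  have gr: "g r \<ge> 0" by (rule nonneg[OF rS])
  have "r \<bullet> r = 0"
  proof (rule ccontr)
    assume "r \<bullet> r \<noteq> 0"
    then have pos: "r \<bullet> r > 0" by simp
    \<comment> \<open>The minimiser of the parabola is \<open>- (r \<bullet> r) / g r\<close>; adding 1 covers the case \<open>g r = 0\<close>.\<close>
    let ?t = "- (r \<bullet> r) / (g r + 1)"
    have "2 * ?t * (r \<bullet> r) + ?t\<^sup>2 * g r = - (r \<bullet> r)\<^sup>2 * (g r + 2) / (g r + 1)\<^sup>2"
      using gr by (simp add: divide_simps power2_eq_square) (simp add: algebra_simps)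
    also have "\<dots> < 0"
      using pos gr by (simp add: divide_simps)
    finally show False using var[of ?t] by simp
  qed
  then have "f v = c *\<^sub>R v" by (simp add: r_def)
  with that vS nv show ?thesis by blast
qed

text \<open>Induction on the dimension: splitting off one eigenvector leaves its orthogonal complement,
  which is again invariant because the map is self-adjoint.\<close>

lemma selfadjoint_orthonormal_eigenbasis:
  fixes f :: "'a::euclidean_space \<Rightarrow> 'a"
  assumes lin: "linear f" and sym: "\<And>x y. f x \<bullet> y = x \<bullet> f y"
    and "subspace S" "f ` S \<subseteq> S"
  shows "\<exists>B\<subseteq>S. finite B \<and> card B = dim S \<and> pairwise orthogonal B \<and>
           (\<forall>b\<in>B. norm b = 1 \<and> (\<exists>c. f b = c *\<^sub>R b))"
  using assms(3,4)
proof (induction "dim S" arbitrary: S)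
  case 0
  then show ?case by (intro exI[of _ "{}"]) auto
next
  case (Suc n)
  from Suc.hyps(2) have "S \<noteq> {0}" by auto
  then obtain v c where v: "v \<in> S" "norm v = 1" "f v = c *\<^sub>R v"
    using selfadjoint_eigenvector_in_invariant_subspace[OF lin sym Suc.prems] by blast
  let ?T = "{y \<in> S. orthogonal v y}"
  have T_span: "?T = {y \<in> S. \<forall>x\<in>span {v}. orthogonal x y}"
  proof -
    have "orthogonal x y" if "orthogonal v y" "x \<in> span {v}" for x y
      using orthogonal_to_span[OF that(2), of y] that(1) by (simp add: orthogonal_commute)
    then show ?thesis using span_base[of v "{v}"] by auto
  qed
  have "dim ?T + dim (span {v}) = dim S"
    unfolding T_span
    by (rule dim_subspace_orthogonal_to_vectors)
       (use v Suc.prems in \<open>simp_all add: span_minimal\<close>)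
  moreover have "dim (span {v}) = 1"
    using v(2) by (auto simp: dim_insert)
  ultimately have dimT: "n = dim ?T"
    using Suc.hyps(2) by simp
  have subT: "subspace ?T"
    using Suc.prems(1) by (auto simp: subspace_def orthogonal_clauses)
  have "f ` ?T \<subseteq> ?T"
  proof safe
    fix y assume y: "y \<in> S" "orthogonal v y"
    then show "f y \<in> S" using Suc.prems(2) by auto
    have "v \<bullet> f y = f v \<bullet> y" by (simp add: sym)
    then show "orthogonal v (f y)"
      using y(2) v(3) by (simp add: orthogonal_def)
  qed
  from Suc.hyps(1)[OF dimT subT this] obtain B where
    B: "B \<subseteq> ?T" "finite B" "card B = dim ?T" "pairwise orthogonal B"
       "\<forall>b\<in>B. norm b = 1 \<and> (\<exists>c. f b = c *\<^sub>R b)" by blast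
  have "v \<notin> B"
    using B(1) v(2) by (auto simp: orthogonal_self)
  then have "card (insert v B) = dim S"
    using B(2,3) dimT Suc.hyps(2) by simp
  moreover have "pairwise orthogonal (insert v B)"
    using B(1,4) by (auto simp: pairwise_insert orthogonal_commute)
  ultimately show ?case
    using B v by (intro exI[of _ "insert v B"]) auto
qed

text \<open>The index type of the basis is that of the coordinates, so that the basis vectors can serve
  as the columns of a square matrix and the eigenvalues are listed with multiplicity.\<close>

definition orthonormal_eigenbasis ::
  "real^'n^'n \<Rightarrow> ('n \<Rightarrow> real^'n) \<Rightarrow> ('n \<Rightarrow> real) \<Rightarrow> bool" where
  "orthonormal_eigenbasis A b d \<longleftrightarrow>
     (\<forall>i j. b i \<bullet> b j = (if i = j then 1 else 0)) \<and> (\<forall>i. A *v b i = d i *\<^sub>R b i)"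

lemma symmetric_matrix_inner:
  fixes A :: "real^'n::finite^'n"
  assumes "transpose A = A"
  shows "(A *v x) \<bullet> y = x \<bullet> (A *v y)"
  by (metis assms dot_lmul_matrix transpose_matrix_vector)

lemma symmetric_matrix_has_orthonormal_eigenbasis:
  fixes A :: "real^'n::finite^'n"
  assumes "transpose A = A"
  obtains b d where "orthonormal_eigenbasis A b d"
proof -
  obtain B :: "(real^'n) set" where B: "finite B" "card B = dim (UNIV :: (real^'n) set)"
      "pairwise orthogonal B" "\<forall>v\<in>B. norm v = 1 \<and> (\<exists>c. A *v v = c *\<^sub>R v)"
    using selfadjoint_orthonormal_eigenbasis[OF matrix_vector_mul_linear
        symmetric_matrix_inner[OF assms] subspace_UNIV subset_UNIV] by blast
  obtain b where b: "bij_betw b (UNIV :: 'n set) B"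
    using finite_same_card_bij[of "UNIV :: 'n set" B] B(1,2) by (auto simp: dim_UNIV)
  then have bB: "b i \<in> B" for i
    by (auto simp: bij_betw_def)
  have "\<forall>i. \<exists>c. A *v b i = c *\<^sub>R b i"
    using B(4) bB by blast
  then obtain d where d: "\<And>i. A *v b i = d i *\<^sub>R b i"
    unfolding choice_iff by blast
  have "b i \<bullet> b j = (if i = j then 1 else 0)" for i j
  proof (cases "i = j")
    case True
    then show ?thesis using B(4) bB[of j] by (simp add: norm_eq_1)
  next
    case False
    then have "b i \<noteq> b j" using b by (auto simp: bij_betw_def inj_def)
    then show ?thesis using B(3) bB False by (auto simp: pairwise_def orthogonal_def)
  qed
  with d that show ?thesis by (auto simp: orthonormal_eigenbasis_def)
qed

lemma eigenbasis_inner: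
  assumes "orthonormal_eigenbasis A b d"
  shows "b i \<bullet> b j = (if i = j then 1 else 0)"
  using assms by (simp add: orthonormal_eigenbasis_def)

lemma eigenbasis_eigenvector:
  assumes "orthonormal_eigenbasis A b d"
  shows "A *v b i = d i *\<^sub>R b i"
  using assms by (simp add: orthonormal_eigenbasis_def)

lemma eigenbasis_expansion:
  fixes A :: "real^'n::finite^'n"
  assumes "orthonormal_eigenbasis A b d"
  shows "(\<Sum>i\<in>UNIV. (x \<bullet> b i) *\<^sub>R b i) = x"
proof -
  note inner = eigenbasis_inner[OF assms]
  have inj: "inj b"
    by (rule injI) (metis inner zero_neq_one)
  have orth: "pairwise orthogonal (range b)"
    by (auto simp: pairwise_def orthogonal_def inner)
  have norm: "norm v = 1" if "v \<in> range b" for v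
    using that by (auto simp: norm_eq_1 inner)
  have "independent (range b)"
    by (rule pairwise_orthogonal_independent[OF orth]) (metis norm norm_zero zero_neq_one)
  moreover have "card (range b) = dim (UNIV :: (real^'n) set)"
    using inj by (simp add: card_image dim_UNIV)
  ultimately have "UNIV \<subseteq> span (range b)"
    using card_eq_dim[of "range b" UNIV] by simp
  then have "(\<Sum>v\<in>range b. (x \<bullet> v) *\<^sub>R v) = x"
    by (intro orthonormal_basis_expand orth norm) auto
  then show ?thesis
    by (simp add: sum.reindex[OF inj])
qed

lemma eigenbasis_norm_square:
  fixes A :: "real^'n::finite^'n"
  assumes "orthonormal_eigenbasis A b d"
  shows "(norm x)\<^sup>2 = (\<Sum>i\<in>UNIV. (x \<bullet> b i)\<^sup>2)"
proof -
  have "(norm x)\<^sup>2 = x \<bullet> (\<Sum>i\<in>UNIV. (x \<bullet> b i) *\<^sub>R b i)"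
    by (simp add: eigenbasis_expansion[OF assms] power2_norm_eq_inner)
  then show ?thesis
    by (simp add: inner_sum_right power2_eq_square)
qed

lemma eigenbasis_coordinate_image:
  fixes A :: "real^'n::finite^'n"
  assumes "transpose A = A" "orthonormal_eigenbasis A b d"
  shows "(A *v x) \<bullet> b i = d i * (x \<bullet> b i)"
  by (simp add: symmetric_matrix_inner[OF assms(1)] eigenbasis_eigenvector[OF assms(2)])

section \<open>The ordered spectrum\<close>

text \<open>Evaluation turns the determinant over polynomials into one over the reals, where the
  eigenbasis can be used as a change of coordinates.\<close>

lemma poly_charpoly:
  fixes A :: "real^'n::finite^'n"
  shows "poly (charpoly A) t = det (mat t - A)"
  unfolding charpoly_def det_def
  by (simp add: poly_sum poly_prod mat_def if_distrib[of "\<lambda>p. poly p t"] cong: if_cong)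

text \<open>The matrix \<open>P\<close> with the basis vectors as columns diagonalises \<open>t I - A\<close> for every \<open>t\<close>, and
  its determinant cancels. The two polynomials agree at all reals, hence are equal.\<close>

lemma charpoly_eigenbasis:
  fixes A :: "real^'n::finite^'n"
  assumes "orthonormal_eigenbasis A b d"
  shows "charpoly A = (\<Prod>i\<in>UNIV. [:- d i, 1:])"
proof -
  note inner = eigenbasis_inner[OF assms] and eig = eigenbasis_eigenvector[OF assms]
  let ?P = "\<chi> a i. b i $ a"
  have "transpose ?P ** ?P = mat 1"
    using inner by (simp add: vec_eq_iff matrix_matrix_mult_def transpose_def mat_def inner_vec_def)
  then have detP: "det ?P * det ?P = 1"
    by (metis det_I det_mul det_transpose)
  have "poly (charpoly A) t = poly (\<Prod>i\<in>UNIV. [:- d i, 1:]) t" for t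
  proof -
    let ?D = "\<chi> i j. if i = j then t - d i else 0"
    have "(mat t - A) ** ?P = ?P ** ?D"
    proof -
      have "mat t *v b i = t *\<^sub>R b i" for i
        by (simp add: vec_eq_iff mat_def matrix_vector_mult_def mult_delta_left)
      then have "(mat t - A) *v b i = (t - d i) *\<^sub>R b i" for i
        by (simp add: matrix_vector_mult_diff_rdistrib eig scaleR_left_diff_distrib)
      then have "((mat t - A) *v b i) $ a = (t - d i) * b i $ a" for a i
        by simp
      then show ?thesis
        by (simp add: vec_eq_iff matrix_matrix_mult_def matrix_vector_mult_def
            mult_delta_right mult.commute)
    qed
    from arg_cong[OF this, of det] have "det (mat t - A) * det ?P = det ?P * det ?D"
      by (simp only: det_mul)
    then have "det (mat t - A) = det ?D"
      using detP by auto
    also have "\<dots> = (\<Prod>i\<in>UNIV. t - d i)"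
      by (subst det_diagonal) auto
    finally show ?thesis
      by (simp add: poly_charpoly poly_prod)
  qed
  then show ?thesis
    by (intro poly_eq_poly_eq_iff[THEN iffD1] ext)
qed

lemma proots_charpoly_eigenbasis:
  fixes A :: "real^'n::finite^'n"
  assumes "orthonormal_eigenbasis A b d"
  shows "proots (charpoly A) = image_mset d (mset_set UNIV)"
proof -
  have "proots (charpoly A) = (\<Sum>i\<in>UNIV. {#d i#})"
    by (simp add: charpoly_eigenbasis[OF assms] proots_prod)
  also have "\<dots> = image_mset d (mset_set UNIV)"
    by (simp add: sum_unfold_sum_mset)
  finally show ?thesis .
qed

lemma sorted_list_of_multiset_add_least:
  assumes "\<And>y. y \<in># M \<Longrightarrow> x \<le> y"
  shows "sorted_list_of_multiset (add_mset x M) = x # sorted_list_of_multiset M"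
  using assms by (simp add: insort_is_Cons)

text \<open>The eigenvalue \<open>d j\<close> may equal \<open>d i\<close> or other eigenvalues: the two smallest are singled out by
  their indices, so that multiplicities are respected.\<close>

lemma eigenvalue_nth_2_eigenbasis:
  fixes A :: "real^'n::finite^'n"
  assumes basis: "orthonormal_eigenbasis A b d"
    and "j \<noteq> i" and least: "\<And>l. d i \<le> d l" and second: "\<And>l. l \<noteq> i \<Longrightarrow> d j \<le> d l"
  shows "eigenvalue_nth 2 A = d j"
proof -
  have "mset_set (UNIV :: 'n set) = add_mset i (add_mset j (mset_set (UNIV - {i} - {j})))"
    using \<open>j \<noteq> i\<close> mset_set.remove[of "UNIV :: 'n set" i] mset_set.remove[of "UNIV - {i}" j]
    by simp
  then have "proots (charpoly A) =
      add_mset (d i) (add_mset (d j) (image_mset d (mset_set (UNIV - {i} - {j}))))"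
    by (simp add: proots_charpoly_eigenbasis[OF basis])
  then have "sorted_list_of_multiset (proots (charpoly A)) =
      d i # d j # sorted_list_of_multiset (image_mset d (mset_set (UNIV - {i} - {j})))"
    by (simp only:) (subst sorted_list_of_multiset_add_least,
        auto intro: least second simp del: sorted_list_of_multiset_insert
        intro!: sorted_list_of_multiset_add_least)
  then show ?thesis
    by (simp add: eigenvalue_nth_def)
qed

section \<open>The stiffness matrix of a connected spring network\<close>

lemma spring_doubleton:
  assumes "springs E" "e \<in> E"
  obtains i j where "e = {i, j}"
proof -
  have "\<exists>i j. i \<noteq> j \<and> e = {i, j}"
    using assms by (simp add: springs_def)
  then show ?thesis
    by (elim exE conjE) (rule that)
qed

lemma transpose_stiffness:
  fixes E :: "'n::finite set set"
  assumes "springs E"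
  shows "transpose (stiffness E k x) = stiffness E k x"
proof -
  have "spring_matrix e $ a $ b = spring_matrix e $ b $ a" if spring: "e \<in> E" for e a b
  proof -
    obtain i j where e: "e = {i, j}"
      using assms spring by (rule spring_doubleton)
    show ?thesis
      unfolding e spring_matrix_doubleton by (simp add: outer_def)
  qed
  then show ?thesis
    by (simp add: stiffness_def transpose_def vec_eq_iff)
qed

lemma outer_mult_vec:
  fixes u v w :: "real^'n::finite"
  shows "outer u v *v w = (v \<bullet> w) *\<^sub>R u"
  by (simp add: vec_eq_iff outer_def matrix_vector_mult_def inner_vec_def sum_distrib_left
      sum_distrib_right mult_ac)

lemma spring_matrix_mult_vec:
  fixes i j :: "'n::finite"
  shows "spring_matrix {i, j} *v w = (w $ i - w $ j) *\<^sub>R (axis i 1 - axis j 1)"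
  by (simp add: spring_matrix_doubleton outer_mult_vec inner_diff_left inner_axis')

lemma stiffness_mult_vec:
  fixes E :: "'n::finite set set"
  shows "stiffness E k x *v w = (\<Sum>e\<in>E. (x e * k e) *\<^sub>R (spring_matrix e *v w))"
proof -
  have "(\<Sum>e\<in>F. (x e * k e) *\<^sub>R spring_matrix e) *v w
      = (\<Sum>e\<in>F. (x e * k e) *\<^sub>R (spring_matrix e *v w))" if "finite F" for F :: "'n set set"
    using that by induction (auto simp: matrix_vector_mult_add_rdistrib scaleR_matrix_vector_assoc)
  then show ?thesis by (simp add: stiffness_def)
qed

lemma stiffness_e0:
  fixes E :: "'n::finite set set"
  assumes "springs E"
  shows "stiffness E k x *v e0 = 0"
proof -
  have "spring_matrix e *v e0 = 0" if e: "e \<in> E" for e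
  proof -
    obtain i j where "e = {i, j}"
      using assms e by (rule spring_doubleton)
    then show ?thesis
      by (simp add: spring_matrix_mult_vec e0_def)
  qed
  then show ?thesis
    by (simp add: stiffness_mult_vec)
qed

text \<open>Twice the elastic energy of a spring of unit stiffness: its squared elongation.\<close>

lemma spring_energy:
  fixes i j :: "'n::finite"
  shows "w \<bullet> (spring_matrix {i, j} *v w) = (w $ i - w $ j)\<^sup>2"
  by (simp add: spring_matrix_mult_vec inner_diff_right inner_axis power2_eq_square)

lemma stiffness_energy:
  fixes E :: "'n::finite set set"
  shows "w \<bullet> (stiffness E k x *v w) = (\<Sum>e\<in>E. x e * k e * (w \<bullet> (spring_matrix e *v w)))"
  by (simp add: stiffness_mult_vec inner_sum_right)

lemma stiffness_energy_terms_nonneg: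
  fixes E :: "'n::finite set set"
  assumes "springs E" "\<forall>e\<in>E. k e > 0" "x \<in> topologies E" "e \<in> E"
  shows "0 \<le> x e * k e * (w \<bullet> (spring_matrix e *v w))"
proof -
  obtain i j where "e = {i, j}"
    using assms(1,4) by (rule spring_doubleton)
  moreover have "x e \<in> {0, 1}"
    using assms(3,4) by (auto simp: topologies_def)
  ultimately show ?thesis
    using assms(2,4) by (auto simp: spring_energy less_imp_le)
qed

lemma stiffness_positive_semidefinite:
  fixes E :: "'n::finite set set"
  assumes "springs E" "\<forall>e\<in>E. k e > 0" "x \<in> topologies E"
  shows "0 \<le> w \<bullet> (stiffness E k x *v w)"
  unfolding stiffness_energy by (intro sum_nonneg stiffness_energy_terms_nonneg[OF assms])

text \<open>A displacement in the kernel has zero energy, so each term of the energy vanishes and no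
  selected spring is elongated. Equality of displacements then spreads along the paths of
  selected springs.\<close>

lemma stiffness_kernel:
  fixes E :: "'n::finite set set"
  assumes E: "springs E" and k: "\<forall>e\<in>E. k e > 0"
    and x: "x \<in> single_rigid_body_topologies E"
    and ker: "stiffness E k x *v w = 0"
  shows "\<exists>c. w = c *\<^sub>R e0"
proof -
  have top: "x \<in> topologies E"
    and conn: "\<And>i j. (i, j) \<in> {(a, b). {a, b} \<in> E \<and> x {a, b} = 1}\<^sup>*"
    using x by (auto simp: single_rigid_body_topologies_def)
  have "(\<Sum>e\<in>E. x e * k e * (w \<bullet> (spring_matrix e *v w))) = 0"
    using ker by (simp flip: stiffness_energy)
  then have zero: "x e * k e * (w \<bullet> (spring_matrix e *v w)) = 0" if "e \<in> E" for e
    using that stiffness_energy_terms_nonneg[OF E k top] by (simp add: sum_nonneg_eq_0_iff)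
  have edge: "w $ a = w $ b" if "{a, b} \<in> E" "x {a, b} = 1" for a b
    using zero[OF that(1)] that k by (auto simp: spring_energy)
  have "w $ i = w $ j" for i j
    using conn[of i j] by (induction rule: rtrancl_induct) (auto dest: edge)
  then have "w = (w $ undefined) *\<^sub>R e0"
    by (simp add: vec_eq_iff e0_def)
  then show ?thesis ..
qed

text \<open>As \<open>e0\<close> lies in the kernel, any basis vector not orthogonal to it has eigenvalue zero. A
  second basis vector with eigenvalue zero would also be a multiple of \<open>e0\<close>, which contradicts
  orthogonality.\<close>

lemma stiffness_spectrum:
  fixes E :: "'n::finite set set"
  assumes E: "springs E" and k: "\<forall>e\<in>E. k e > 0" and x: "x \<in> single_rigid_body_topologies E"
    and basis: "orthonormal_eigenbasis (stiffness E k x) b d"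
  obtains i where "d i = 0" "\<And>l. l \<noteq> i \<Longrightarrow> d l > 0"
proof -
  let ?L = "stiffness E k x"
  note inner = eigenbasis_inner[OF basis] and eig = eigenbasis_eigenvector[OF basis]
  have "(e0 :: real^'n) \<noteq> 0" by (simp add: e0_def vec_eq_iff)
  then obtain i where i: "e0 \<bullet> b i \<noteq> 0"
    using eigenbasis_expansion[OF basis, of e0] by fastforce
  have "d i * (e0 \<bullet> b i) = 0"
    using eigenbasis_coordinate_image[OF transpose_stiffness[OF E] basis, of e0 i]
    by (simp add: stiffness_e0[OF E])
  then have di: "d i = 0" using i by simp
  have "d l > 0" if "l \<noteq> i" for l
  proof -
    have "d l \<ge> 0"
      using stiffness_positive_semidefinite[OF E k, of x "b l"] x
      by (simp add: single_rigid_body_topologies_def eig inner)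
    moreover have "d l \<noteq> 0"
    proof
      assume "d l = 0"
      then obtain s where s: "b l = s *\<^sub>R e0"
        using stiffness_kernel[OF E k x, of "b l"] by (auto simp: eig)
      then have "s \<noteq> 0" using inner[of l l] by auto
      moreover have "b l \<bullet> b i = 0" using that by (simp add: inner)
      ultimately show False using s i by simp
    qed
    ultimately show ?thesis by simp
  qed
  with di that show ?thesis by blast
qed

section \<open>Steady states\<close>

text \<open>Velocity and acceleration are unique as derivatives, so both vanish at a constant
  displacement and only the static equilibrium equation remains.\<close>

lemma motion_constant_iff:
  "motion M K f (\<lambda>t. c) v \<longleftrightarrow> v = (\<lambda>t. 0) \<and> K *v c = f"
proof
  assume "motion M K f (\<lambda>t. c) v"
  then obtain a where a: "\<And>t. ((\<lambda>t. c) has_vector_derivative v t) (at t)"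
     "\<And>t. (v has_vector_derivative a t) (at t)" "\<And>t. M *v a t + K *v c = f"
    by (auto simp: motion_def)
  have v: "v = (\<lambda>t. 0)"
    using vector_derivative_unique_at[OF a(1) has_vector_derivative_const] by auto
  then have "a 0 = 0"
    using vector_derivative_unique_at[OF a(2)[of 0, unfolded v] has_vector_derivative_const] by auto
  with a(3)[of 0] v show "v = (\<lambda>t. 0) \<and> K *v c = f" by simp
next
  assume "v = (\<lambda>t. 0) \<and> K *v c = f"
  then show "motion M K f (\<lambda>t. c) v"
    unfolding motion_def by (intro exI[of _ "\<lambda>t. 0"]) auto
qed

lemma average_eq_0_iff: "average (u :: real^'n::finite) = 0 \<longleftrightarrow> u \<bullet> e0 = 0"
  by (simp add: average_def inner_commute)

text \<open>Two equilibria with zero average differ by a multiple of \<open>e0\<close> that is also orthogonal to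
  \<open>e0\<close>, so the definite description is justified.\<close>

lemma steady_state_eqI:
  fixes K :: "real^'n::finite^'n"
  assumes ker: "\<And>w. K *v w = 0 \<Longrightarrow> \<exists>c. w = c *\<^sub>R e0"
    and c: "K *v c = f" "c \<bullet> e0 = 0"
  shows "steady_state M K f = c"
proof -
  have unique: "c' = c" if "K *v c' = f" "c' \<bullet> e0 = 0" for c'
  proof -
    have "K *v (c' - c) = 0"
      using that(1) c(1) by (simp add: matrix_vector_mult_diff_distrib)
    then obtain s where s: "c' - c = s *\<^sub>R e0" using ker by blast
    have "(c' - c) \<bullet> (c' - c) = s * ((c' - c) \<bullet> e0)"
      by (subst (2) s) simp
    moreover have "(c' - c) \<bullet> e0 = 0"
      using that(2) c(2) by (simp add: inner_diff_left)
    ultimately have "(c' - c) \<bullet> (c' - c) = 0" by simp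
    then show ?thesis by (simp only: inner_eq_zero_iff right_minus_eq)
  qed
  have "(\<exists>v. (v = (\<lambda>t. 0) \<and> K *v c' = f) \<and> average c' = 0 \<and> average (v (0 :: real) :: real^'n) = 0)
      \<longleftrightarrow> c' = c" for c'
    using unique[of c'] c by (auto simp: average_eq_0_iff)
  then show ?thesis
    unfolding steady_state_def motion_constant_iff by simp
qed

text \<open>The pseudoinverse in coordinates. The basis vector with eigenvalue zero spans the rigid
  motions, to which \<open>f\<close> is orthogonal, so dropping it loses no component of \<open>f\<close>.\<close>

lemma steady_state_eigenbasis:
  fixes K :: "real^'n::finite^'n"
  assumes ker: "\<And>w. K *v w = 0 \<Longrightarrow> \<exists>c. w = c *\<^sub>R e0"
    and basis: "orthonormal_eigenbasis K b d"
    and i: "d i = 0" "\<And>l. l \<noteq> i \<Longrightarrow> d l \<noteq> 0"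
    and f: "f \<bullet> e0 = 0"
  shows "steady_state M K f = (\<Sum>l\<in>UNIV - {i}. (f \<bullet> b l / d l) *\<^sub>R b l)" (is "_ = ?c")
proof (rule steady_state_eqI[OF ker])
  note inner = eigenbasis_inner[OF basis] and eig = eigenbasis_eigenvector[OF basis]
  obtain s where s: "b i = s *\<^sub>R e0"
    using ker[of "b i"] eig[of i] i(1) by auto
  have s0: "s \<noteq> 0" using s inner[of i i] by auto
  have fi: "f \<bullet> b i = 0" using f s by simp
  have "K *v ?c = (\<Sum>l\<in>UNIV - {i}. (f \<bullet> b l) *\<^sub>R b l)"
    using i(2) by (simp add: linear_sum[OF matrix_vector_mul_linear] matrix_vector_mult_scaleR eig)
  also have "\<dots> = (\<Sum>l\<in>UNIV. (f \<bullet> b l) *\<^sub>R b l)"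
    using fi by (simp add: sum.remove[of UNIV i])
  finally show "K *v ?c = f" by (simp add: eigenbasis_expansion[OF basis])
  have "?c \<bullet> b i = 0"
    by (simp add: inner_sum_left inner)
  then show "?c \<bullet> e0 = 0" using s s0 by simp
qed

section \<open>The largest steady-state displacement\<close>

theorem lemma1:
  fixes E :: "'n::finite set set" and k x :: "'n set \<Rightarrow> real" and m :: real
  assumes "CARD('n) \<ge> 2"
    and "m > 0"
    and "springs E"
    and "\<forall>e\<in>E. k e > 0"
    and "x \<in> single_rigid_body_topologies E"
  shows "(\<exists>f\<in>admissible_forces.
            norm (steady_state (mat m) (stiffness E k x) f) = 1 / eigenvalue_nth 2 (stiffness E k x)) \<and>
         (\<forall>f\<in>admissible_forces.
            norm (steady_state (mat m) (stiffness E k x) f) \<le> 1 / eigenvalue_nth 2 (stiffness E k x))"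
proof -
  let ?L = "stiffness E k x"
  let ?S = "steady_state (mat m) ?L"
  note kernel = stiffness_kernel[OF assms(3-5)]
  obtain b d where basis: "orthonormal_eigenbasis ?L b d"
    using symmetric_matrix_has_orthonormal_eigenbasis transpose_stiffness[OF assms(3)] by blast
  note inner = eigenbasis_inner[OF basis]
  obtain i where i: "d i = 0" "\<And>l. l \<noteq> i \<Longrightarrow> d l > 0"
    using stiffness_spectrum[OF assms(3-5) basis] by blast
  have "UNIV - {i} \<noteq> {}"
  proof
    assume "UNIV - {i} = {}"
    then have "(UNIV :: 'n set) = {i}" by auto
    from arg_cong[OF this, of card] show False using assms(1) by simp
  qed
  then obtain j where j: "j \<noteq> i" "\<And>l. l \<noteq> i \<Longrightarrow> d j \<le> d l"
    using ex_min_if_finite[of "d ` (UNIV - {i})"] by (force simp: not_less)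
  have eigenvalue: "eigenvalue_nth 2 ?L = d j"
    by (rule eigenvalue_nth_2_eigenbasis[OF basis j(1) _ j(2)]) (metis i less_imp_le order_refl)
  have dj: "d j > 0" using i(2) j(1) .
  have state: "?S f = (\<Sum>l\<in>UNIV - {i}. (f \<bullet> b l / d l) *\<^sub>R b l)" if "f \<bullet> e0 = 0" for f
    by (rule steady_state_eigenbasis[OF kernel basis i(1) _ that]) (use i(2) in force)+
  have orth: "b j \<bullet> e0 = 0"
  proof -
    have "d j * (e0 \<bullet> b j) = 0"
      using eigenbasis_coordinate_image[OF transpose_stiffness[OF assms(3)] basis, of e0 j]
      by (simp add: stiffness_e0[OF assms(3)])
    then show ?thesis using dj by (simp add: inner_commute)
  qed
  show ?thesis
  proof (intro conjI ballI bexI)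
    have "?S (b j) = (\<Sum>l\<in>UNIV - {i}. if l = j then (1 / d j) *\<^sub>R b j else 0)"
      unfolding state[OF orth] by (intro sum.cong) (auto simp: inner)
    also have "\<dots> = (1 / d j) *\<^sub>R b j"
      using j(1) by simp
    finally show "norm (?S (b j)) = 1 / eigenvalue_nth 2 ?L"
      using dj inner[of j j] by (simp add: eigenvalue norm_eq_1)
    show "b j \<in> admissible_forces"
      using orth inner[of j j] norm_eq_1[of "b j"] by (simp add: admissible_forces_def)
  next
    fix f :: "real^'n" assume "f \<in> admissible_forces"
    then have f: "norm f \<le> 1" "f \<bullet> e0 = 0" by (auto simp: admissible_forces_def)
    \<comment> \<open>For \<open>l = i\<close> the left side is zero; otherwise \<open>d j\<close> is the smallest possible divisor.\<close>
    have coord: "(?S f \<bullet> b l)\<^sup>2 \<le> (f \<bullet> b l)\<^sup>2 / (d j)\<^sup>2" for l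
    proof (cases "l = i")
      case False
      have "?S f \<bullet> b l = f \<bullet> b l / d l"
        using False by (simp add: state[OF f(2)] inner_sum_left inner mult_delta_right)
      moreover have "(d j)\<^sup>2 \<le> (d l)\<^sup>2"
        using j(2)[OF False] dj by (intro power_mono) auto
      ultimately show ?thesis
        using dj by (simp add: power_divide frac_le)
    qed (simp add: state[OF f(2)] inner_sum_left inner)
    have "(norm (?S f))\<^sup>2 \<le> (\<Sum>l\<in>UNIV. (f \<bullet> b l)\<^sup>2 / (d j)\<^sup>2)"
      unfolding eigenbasis_norm_square[OF basis, of "?S f"] by (intro sum_mono coord)
    also have "\<dots> = (norm f / d j)\<^sup>2"
      by (simp add: eigenbasis_norm_square[OF basis, of f] power_divide sum_divide_distrib)
    finally have "norm (?S f) \<le> norm f / d j"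
      by (rule power2_le_imp_le) (use dj in simp)
    also have "\<dots> \<le> 1 / d j"
      using f(1) dj by (simp add: divide_right_mono)
    finally show "norm (?S f) \<le> 1 / eigenvalue_nth 2 ?L"
      by (simp add: eigenvalue)
  qed
qed

end
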